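(* Let $X$ be an Archimedean vector lattice satisfying condition (R), and let $(T_s)_{s\ge 0}$ be a positive semigroup on $X$ with property $\mathbf{ruc}_0$. Let $(T_s^r)_{s\ge 0}$ be the unique positive semigroup on the ru-completion $X^r$ extending $(T_s)_{s\ge 0}$. Then $(T_s^r)_{s\ge 0}$ has property $\mathbf{ruc}$ (on $X^r$).
   Context: All vector spaces are real and all operators are linear. A semigroup on a vector space $V$ is a family $(T_s)_{s\ge 0}$ of linear operators $V\to V$ such that $T_{s+t}=T_sT_t$ for all $s,t\in\mathbb{R}_+$ and $T_0=I_V$. A semigroup on a vector lattice is positive if every $T_s$ is a positive operator. Condition (R): a vector lattice $X$ satisfies (R) if for each sequence $(y_k)$ in $X$ there exist $y\in X$ and a sequence $(\lambda_k)$ of (strictly) positive scalars such that $|\lambda_ky_k|\le y$ for all $k$. ru-convergence: let $Y$ be an Archimedean vector lattice. A net $(x_\alpha)$ in $Y$ ru-converges to $x\in Y$ with regulator $u\in Y$, written $x_\alpha\xrightarrow{(ru)}x(u)$, if for every $k\in\mathbb{N}$ there is $\alpha_k$ with $|x_\alpha-x|\le\frac1k|u|$ for all $\alpha\ge\alpha_k$; $x_\alpha\xrightarrow{(ru)}x$ means that this holds for some regulator $u\in Y$. A net $(x_\alpha)$ is ru-Cauchy with regulator $u$ if for every $k\in\mathbb{N}$ there is $\alpha_k$ with $|x_\alpha-x_{\alpha'}|\le\frac1k|u|$ for all $\alpha,\alpha'\ge\alpha_k$. $Y$ is ru-complete in itself if for every ru-Cauchy net $(x_\alpha)$ in $Y$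 with a regulator in $Y$ there exist $x,w\in Y$ with $x_\alpha\xrightarrow{(ru)}x(w)$ (it is equivalent to require this for sequences only). Continuity properties of a semigroup $(S_s)_{s\ge 0}$ on an Archimedean vector lattice $Y$: - $\mathbf{ruc}_0$: for every $x\in Y$, $S_hx\xrightarrow{(ru)}x$ as $h\downarrow 0$; i.e. there is $u\in Y$ such that for each $\varepsilon>0$ there is $\delta>0$ with $|S_hx-x|\le\varepsilon|u|$ whenever $0\le h<\delta$. - $\mathbf{ruc}$: for every $x\in Y$ and $s\ge 0$, $S_{s+h}x\xrightarrow{(ru)}S_sx$ as $h\to 0$; i.e. there is $u\in Y$ such that for each $\varepsilon>0$ there is $\delta>0$ with $|S_{s+h}x-S_sx|\le\varepsilon|u|$ whenever $|h|<\delta$ and $s+h\ge 0$. An ru-completion of $X$ is a vector lattice $F$, ru-complete in itself, for which there exists a lattice embedding $J:X\to F$ such that for each ru-complete in itself vector lattice $Y$ and each lattice homomorphism $T:X\to Y$ there exists a unique lattice homomorphism $S:F\to Y$ with $S\circ J=T$. It exists and is unique up to lattice isomorphism; it is denoted $X^r$, and $X$ is identified with the sublattice $J(X)$ of $X^r$. Concretely, $X^r$ can be realized as the intersection of all vector sublattices of the order (Dedekind) completion $X^\delta$ that contain $X$ and are ru-complete in themselves. Every positive semigroup $(T_s)_{s\ge 0}$ on an Archimedean vector lattice $X$ has a unique extension to a positive semigroup $(T_s^r)_{s\ge 0}$ on $X^r$ (i.e. $T_s^rx=T_sx$ for all $x\in X$, $s\ge 0$); this is the semigroup $(T_s^r)_{s\ge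 0}$ in the claim. *)

theory Defs
  imports Complex_Main "HOL-Library.Lattice_Algebras"
begin

class vector_lattice = ordered_real_vector + lattice_ab_group_add_abs

section \<open>Vector lattices with an explicit carrier\<close>

text \<open>
  The universal property of the ru-completion quantifies over vector lattices inside a formula.
  Since HOL does not quantify over types, these are given as records with a carrier set.
\<close>

record 'a vl =
  vl_carrier :: "'a set"
  vl_zero :: 'a
  vl_add :: "'a \<Rightarrow> 'a \<Rightarrow> 'a"
  vl_scale :: "real \<Rightarrow> 'a \<Rightarrow> 'a"
  vl_le :: "'a \<Rightarrow> 'a \<Rightarrow> bool"
  vl_sup :: "'a \<Rightarrow> 'a \<Rightarrow> 'a"
  vl_inf :: "'a \<Rightarrow> 'a \<Rightarrow> 'a"

definition vl_minus :: "'a vl \<Rightarrow> 'a \<Rightarrow> 'a \<Rightarrow> 'a" where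
  "vl_minus Y x y = vl_add Y x (vl_scale Y (- 1) y)"

definition vl_abs :: "'a vl \<Rightarrow> 'a \<Rightarrow> 'a" where
  "vl_abs Y x = vl_sup Y x (vl_scale Y (- 1) x)"

locale is_vector_lattice =
  fixes Y :: "'a vl"
  assumes zero_closed: "vl_zero Y \<in> vl_carrier Y"
    and add_closed: "\<lbrakk>x \<in> vl_carrier Y; y \<in> vl_carrier Y\<rbrakk> \<Longrightarrow> vl_add Y x y \<in> vl_carrier Y"
    and scale_closed: "x \<in> vl_carrier Y \<Longrightarrow> vl_scale Y a x \<in> vl_carrier Y"
    and sup_closed: "\<lbrakk>x \<in> vl_carrier Y; y \<in> vl_carrier Y\<rbrakk> \<Longrightarrow> vl_sup Y x y \<in> vl_carrier Y"
    and inf_closed: "\<lbrakk>x \<in> vl_carrier Y; y \<in> vl_carrier Y\<rbrakk> \<Longrightarrow> vl_inf Y x y \<in> vl_carrier Y"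
    and add_assoc: "\<lbrakk>x \<in> vl_carrier Y; y \<in> vl_carrier Y; z \<in> vl_carrier Y\<rbrakk>
      \<Longrightarrow> vl_add Y (vl_add Y x y) z = vl_add Y x (vl_add Y y z)"
    and add_commute: "\<lbrakk>x \<in> vl_carrier Y; y \<in> vl_carrier Y\<rbrakk> \<Longrightarrow> vl_add Y x y = vl_add Y y x"
    and add_zero: "x \<in> vl_carrier Y \<Longrightarrow> vl_add Y (vl_zero Y) x = x"
    and add_inverse: "x \<in> vl_carrier Y \<Longrightarrow> vl_add Y x (vl_scale Y (- 1) x) = vl_zero Y"
    and scale_add_right: "\<lbrakk>x \<in> vl_carrier Y; y \<in> vl_carrier Y\<rbrakk>
      \<Longrightarrow> vl_scale Y a (vl_add Y x y) = vl_add Y (vl_scale Y a x) (vl_scale Y a y)"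
    and scale_add_left: "x \<in> vl_carrier Y
      \<Longrightarrow> vl_scale Y (a + b) x = vl_add Y (vl_scale Y a x) (vl_scale Y b x)"
    and scale_scale: "x \<in> vl_carrier Y \<Longrightarrow> vl_scale Y a (vl_scale Y b x) = vl_scale Y (a * b) x"
    and scale_one: "x \<in> vl_carrier Y \<Longrightarrow> vl_scale Y 1 x = x"
    and le_refl: "x \<in> vl_carrier Y \<Longrightarrow> vl_le Y x x"
    and le_trans: "\<lbrakk>x \<in> vl_carrier Y; y \<in> vl_carrier Y; z \<in> vl_carrier Y; vl_le Y x y; vl_le Y y z\<rbrakk>
      \<Longrightarrow> vl_le Y x z"
    and le_antisym: "\<lbrakk>x \<in> vl_carrier Y; y \<in> vl_carrier Y; vl_le Y x y; vl_le Y y x\<rbrakk> \<Longrightarrow> x = y"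
    and add_mono: "\<lbrakk>x \<in> vl_carrier Y; y \<in> vl_carrier Y; z \<in> vl_carrier Y; vl_le Y x y\<rbrakk>
      \<Longrightarrow> vl_le Y (vl_add Y x z) (vl_add Y y z)"
    and scale_mono: "\<lbrakk>x \<in> vl_carrier Y; y \<in> vl_carrier Y; vl_le Y x y; 0 \<le> a\<rbrakk>
      \<Longrightarrow> vl_le Y (vl_scale Y a x) (vl_scale Y a y)"
    and sup_ge1: "\<lbrakk>x \<in> vl_carrier Y; y \<in> vl_carrier Y\<rbrakk> \<Longrightarrow> vl_le Y x (vl_sup Y x y)"
    and sup_ge2: "\<lbrakk>x \<in> vl_carrier Y; y \<in> vl_carrier Y\<rbrakk> \<Longrightarrow> vl_le Y y (vl_sup Y x y)"
    and sup_least: "\<lbrakk>x \<in> vl_carrier Y; y \<in> vl_carrier Y; z \<in> vl_carrier Y; vl_le Y x z; vl_le Y y z\<rbrakk>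
      \<Longrightarrow> vl_le Y (vl_sup Y x y) z"
    and inf_le1: "\<lbrakk>x \<in> vl_carrier Y; y \<in> vl_carrier Y\<rbrakk> \<Longrightarrow> vl_le Y (vl_inf Y x y) x"
    and inf_le2: "\<lbrakk>x \<in> vl_carrier Y; y \<in> vl_carrier Y\<rbrakk> \<Longrightarrow> vl_le Y (vl_inf Y x y) y"
    and inf_greatest: "\<lbrakk>x \<in> vl_carrier Y; y \<in> vl_carrier Y; z \<in> vl_carrier Y; vl_le Y z x; vl_le Y z y\<rbrakk>
      \<Longrightarrow> vl_le Y z (vl_inf Y x y)"

definition vl_of_type :: "'a::vector_lattice vl" where
  "vl_of_type = \<lparr>vl_carrier = UNIV, vl_zero = 0, vl_add = (+), vl_scale = scaleR,
     vl_le = (\<le>), vl_sup = sup, vl_inf = inf\<rparr>"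

lemma vl_of_type_simps [simp]:
  "vl_carrier vl_of_type = UNIV" "vl_zero vl_of_type = 0" "vl_add vl_of_type = (+)"
  "vl_scale vl_of_type = scaleR" "vl_le vl_of_type = (\<le>)"
  "vl_sup vl_of_type = sup" "vl_inf vl_of_type = inf"
  "vl_minus vl_of_type = (-)" "vl_abs vl_of_type = abs"
  by (auto simp: vl_of_type_def vl_minus_def vl_abs_def abs_lattice fun_eq_iff)

lemma is_vector_lattice_vl_of_type: "is_vector_lattice (vl_of_type :: 'a::vector_lattice vl)"
  by unfold_locales
    (auto simp: algebra_simps scaleR_add_right scaleR_add_left intro: scaleR_left_mono order_trans)

text \<open>Archimedean: \<open>inf {(1/n) x | n \<ge> 1} = 0\<close> for every \<open>x \<ge> 0\<close>.\<close>

definition archimedean_vl :: "'a vl \<Rightarrow> bool" where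
  "archimedean_vl Y \<longleftrightarrow> is_vector_lattice Y \<and>
     (\<forall>x\<in>vl_carrier Y. \<forall>z\<in>vl_carrier Y. vl_le Y (vl_zero Y) x \<longrightarrow>
        (\<forall>n::nat. n \<ge> 1 \<longrightarrow> vl_le Y z (vl_scale Y (1 / real n) x)) \<longrightarrow> vl_le Y z (vl_zero Y))"

section \<open>Relatively uniform convergence and completeness\<close>

text \<open>
  A net \<open>f\<close> is rendered as a function together with the filter generated by the tails of its
  index set.
\<close>

definition ru_converges :: "'a vl \<Rightarrow> ('i \<Rightarrow> 'a) \<Rightarrow> 'i filter \<Rightarrow> 'a \<Rightarrow> 'a \<Rightarrow> bool" where
  "ru_converges Y f \<Phi> x u \<longleftrightarrow>
     (\<forall>k::nat. k \<ge> 1 \<longrightarrow>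
        (\<forall>\<^sub>F i in \<Phi>. vl_le Y (vl_abs Y (vl_minus Y (f i) x)) (vl_scale Y (1 / real k) (vl_abs Y u))))"

definition ru_cauchy :: "'a vl \<Rightarrow> ('i \<Rightarrow> 'a) \<Rightarrow> 'i filter \<Rightarrow> 'a \<Rightarrow> bool" where
  "ru_cauchy Y f \<Phi> u \<longleftrightarrow>
     (\<forall>k::nat. k \<ge> 1 \<longrightarrow>
        (\<forall>\<^sub>F (i, j) in \<Phi> \<times>\<^sub>F \<Phi>.
           vl_le Y (vl_abs Y (vl_minus Y (f i) (f j))) (vl_scale Y (1 / real k) (vl_abs Y u))))"

text \<open>
  Completeness is stated for proper filters on the lattice itself. By the lemma
  \<open>ru_complete_net\<close> this covers nets over index sets of every type.
\<close>

definition ru_complete :: "'a vl \<Rightarrow> bool" where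
  "ru_complete Y \<longleftrightarrow> archimedean_vl Y \<and>
     (\<forall>\<Phi>. \<Phi> \<noteq> bot \<and> (\<forall>\<^sub>F y in \<Phi>. y \<in> vl_carrier Y) \<and>
          (\<exists>u\<in>vl_carrier Y. ru_cauchy Y (\<lambda>y. y) \<Phi> u) \<longrightarrow>
        (\<exists>x\<in>vl_carrier Y. \<exists>w\<in>vl_carrier Y. ru_converges Y (\<lambda>y. y) \<Phi> x w))"

lemma ru_complete_net:
  fixes f :: "'i \<Rightarrow> 'a"
  assumes "ru_complete Y" "\<Phi> \<noteq> bot" "\<forall>\<^sub>F i in \<Phi>. f i \<in> vl_carrier Y"
    and "u \<in> vl_carrier Y" "ru_cauchy Y f \<Phi> u"
  shows "\<exists>x\<in>vl_carrier Y. \<exists>w\<in>vl_carrier Y. ru_converges Y f \<Phi> x w"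
proof -
  have "ru_cauchy Y (\<lambda>y. y) (filtermap f \<Phi>) u"
    unfolding ru_cauchy_def
  proof (intro allI impI)
    fix k :: nat assume "k \<ge> 1"
    let ?P = "\<lambda>x y. vl_le Y (vl_abs Y (vl_minus Y x y)) (vl_scale Y (1 / real k) (vl_abs Y u))"
    obtain Q where Q: "eventually Q \<Phi>" "\<And>i j. Q i \<Longrightarrow> Q j \<Longrightarrow> ?P (f i) (f j)"
      using assms(5) \<open>k \<ge> 1\<close> unfolding ru_cauchy_def eventually_prod_same by fastforce
    have "eventually (\<lambda>y. \<exists>i. y = f i \<and> Q i) (filtermap f \<Phi>)"
      unfolding eventually_filtermap using Q(1) by (auto elim: eventually_mono)
    then show "\<forall>\<^sub>F (x, y) in filtermap f \<Phi> \<times>\<^sub>F filtermap f \<Phi>. ?P x y"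
      unfolding eventually_prod_same using Q(2)
      by (intro exI[of _ "\<lambda>y. \<exists>i. y = f i \<and> Q i"]) auto
  qed
  moreover have "filtermap f \<Phi> \<noteq> bot" "\<forall>\<^sub>F y in filtermap f \<Phi>. y \<in> vl_carrier Y"
    using assms(2,3) by (auto simp: filtermap_bot_iff eventually_filtermap)
  ultimately have "\<exists>x\<in>vl_carrier Y. \<exists>w\<in>vl_carrier Y. ru_converges Y (\<lambda>y. y) (filtermap f \<Phi>) x w"
    using assms(1,4) unfolding ru_complete_def by blast
  then show ?thesis
    by (simp add: ru_converges_def eventually_filtermap)
qed

section \<open>The ru-completion\<close>

definition lattice_homomorphism :: "('a::vector_lattice \<Rightarrow> 'b) \<Rightarrow> 'b vl \<Rightarrow> bool" where
  "lattice_homomorphism h Y \<longleftrightarrow>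
     (\<forall>x. h x \<in> vl_carrier Y) \<and>
     (\<forall>x y. h (x + y) = vl_add Y (h x) (h y)) \<and>
     (\<forall>a x. h (a *\<^sub>R x) = vl_scale Y a (h x)) \<and>
     (\<forall>x y. h (sup x y) = vl_sup Y (h x) (h y)) \<and>
     (\<forall>x y. h (inf x y) = vl_inf Y (h x) (h y))"

text \<open>
  \<open>J\<close> exhibits the vector lattice \<open>'b\<close> as an ru-completion of \<open>'a\<close>. The test lattices \<open>Y\<close> are all
  ru-complete vector lattices, with arbitrary operations, whose carrier is a subset of \<open>'b\<close>.
  For Archimedean \<open>'a\<close> this size restriction is harmless: among them are \<open>'b\<close> and the least
  ru-complete sublattice \<open>G\<close> of \<open>'b\<close> containing the range of \<open>J\<close>. Extending \<open>J\<close> to \<open>'b \<Rightarrow> G\<close> and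
  comparing with the identity by uniqueness gives \<open>G = 'b\<close>. The homomorphism from the ru-completion
  of \<open>'a\<close> to \<open>'b\<close> induced by \<open>J\<close> is one-to-one, because its kernel meets the order dense sublattice
  \<open>'a\<close> only in \<open>0\<close>. So its range is an ru-complete sublattice containing the range of \<open>J\<close>, and the
  homomorphism is onto.
\<close>

definition ru_completion :: "('a::vector_lattice \<Rightarrow> 'b::vector_lattice) \<Rightarrow> bool" where
  "ru_completion J \<longleftrightarrow>
     ru_complete (vl_of_type :: 'b vl) \<and>
     lattice_homomorphism J vl_of_type \<and> inj J \<and>
     (\<forall>(Y :: 'b vl) T. ru_complete Y \<and> lattice_homomorphism T Y \<longrightarrow>
        (\<exists>!S. lattice_homomorphism S Y \<and> S \<circ> J = T))"

section \<open>Condition (R) and semigroups\<close>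

definition condition_R :: "'a::vector_lattice itself \<Rightarrow> bool" where
  "condition_R _ \<longleftrightarrow>
     (\<forall>x :: nat \<Rightarrow> 'a. \<exists>y c. \<forall>k. (c k :: real) > 0 \<and> \<bar>c k *\<^sub>R x k\<bar> \<le> y)"

definition semigroup_on :: "(real \<Rightarrow> 'a::real_vector \<Rightarrow> 'a) \<Rightarrow> bool" where
  "semigroup_on S \<longleftrightarrow> (\<forall>s\<ge>0. linear (S s)) \<and> S 0 = id \<and>
     (\<forall>s\<ge>0. \<forall>t\<ge>0. S (s + t) = S s \<circ> S t)"

definition positive_semigroup :: "(real \<Rightarrow> 'a::vector_lattice \<Rightarrow> 'a) \<Rightarrow> bool" where
  "positive_semigroup S \<longleftrightarrow> semigroup_on S \<and> (\<forall>s\<ge>0. \<forall>x\<ge>0. S s x \<ge> 0)"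

definition ruc0 :: "(real \<Rightarrow> 'a::vector_lattice \<Rightarrow> 'a) \<Rightarrow> bool" where
  "ruc0 S \<longleftrightarrow> (\<forall>x. \<exists>u. \<forall>\<epsilon>>0. \<exists>\<delta>>0. \<forall>h. 0 \<le> h \<and> h < \<delta> \<longrightarrow> \<bar>S h x - x\<bar> \<le> \<epsilon> *\<^sub>R \<bar>u\<bar>)"

definition ruc :: "(real \<Rightarrow> 'a::vector_lattice \<Rightarrow> 'a) \<Rightarrow> bool" where
  "ruc S \<longleftrightarrow> (\<forall>x. \<forall>s\<ge>0. \<exists>u. \<forall>\<epsilon>>0. \<exists>\<delta>>0. \<forall>h. \<bar>h\<bar> < \<delta> \<and> s + h \<ge> 0 \<longrightarrow>
     \<bar>S (s + h) x - S s x\<bar> \<le> \<epsilon> *\<^sub>R \<bar>u\<bar>)"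

end

theory Submission
  imports Defs
begin

text \<open>
  Two independent facts carry the proof.

  Under condition (R), one pass of uniform approximation already reaches all of the ru-completion.
  Let \<open>G\<close> be the set of all points that can be approximated by the range of \<open>J\<close> with a regulator
  from the range of \<open>J\<close>. It is a sublattice, and it is ru-complete: a limit of elements of \<open>G\<close>
  involves the regulators of countably many of them, and (R) replaces these by a single one
  (\<open>ru_complete_ru_adherence\<close>). By the universal property \<open>J\<close> extends to a homomorphism
  into \<open>G\<close>, which must be the identity, since the identity is the only endomorphism that fixes
  the range of \<open>J\<close>. Hence \<open>G\<close> is everything (\<open>ru_completion_ru_adherence\<close>).

  On the original lattice, the orbit of every point under the semigroup is order bounded on bounded
  time intervals: continuity at time zero bounds a short initial piece of the orbit, and finitely
  many translates of that piece cover the interval (\<open>orbit_order_bounded\<close>). Such bounds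
  serve as regulators for two-sided continuity (\<open>ruc_of_ruc0\<close>).

  For a point \<open>y\<close> of the completion, choose approximants \<open>J (x n)\<close> with regulator \<open>J u\<close>.
  Then \<open>Tr t y - Tr s y\<close> splits into the increment of the orbit of \<open>x n\<close> and two error terms
  dominated by multiples of \<open>J (T t u)\<close> and \<open>J (T s u)\<close>. Order boundedness of the orbit of \<open>u\<close>
  controls the error terms, and (R) supplies a regulator common to all the increments.
\<close>

section \<open>Vector lattices and lattice homomorphisms\<close>

lemma abs_scaleR_le:
  fixes x :: "'a::vector_lattice"
  assumes "0 \<le> a"
  shows "\<bar>a *\<^sub>R x\<bar> \<le> a *\<^sub>R \<bar>x\<bar>"
proof (rule abs_leI)
  show "a *\<^sub>R x \<le> a *\<^sub>R \<bar>x\<bar>"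
    by (intro scaleR_left_mono assms abs_ge_self)
  have "a *\<^sub>R (- x) \<le> a *\<^sub>R \<bar>x\<bar>"
    by (intro scaleR_left_mono assms abs_ge_minus_self)
  then show "- (a *\<^sub>R x) \<le> a *\<^sub>R \<bar>x\<bar>" by simp
qed

lemma abs_le_inverse_scaleR:
  fixes x :: "'a::vector_lattice"
  assumes "0 < c" "\<bar>c *\<^sub>R x\<bar> \<le> w"
  shows "\<bar>x\<bar> \<le> inverse c *\<^sub>R w"
proof -
  have "\<bar>x\<bar> = \<bar>inverse c *\<^sub>R (c *\<^sub>R x)\<bar>" using assms(1) by simp
  also have "\<dots> \<le> inverse c *\<^sub>R \<bar>c *\<^sub>R x\<bar>"
    using assms(1) by (intro abs_scaleR_le) simp
  also have "\<dots> \<le> inverse c *\<^sub>R w"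
    using assms by (intro scaleR_left_mono) auto
  finally show ?thesis .
qed

lemma sup_le_sup_add_abs:
  fixes a b c d :: "'a::vector_lattice"
  shows "sup a b \<le> sup c d + (\<bar>a - c\<bar> + \<bar>b - d\<bar>)"
proof (rule sup_least)
  have "a = c + (a - c)" by simp
  also have "\<dots> \<le> sup c d + (\<bar>a - c\<bar> + \<bar>b - d\<bar>)"
    by (intro add_mono sup_ge1 order_trans[OF abs_ge_self[of "a - c"]]) simp
  finally show "a \<le> sup c d + (\<bar>a - c\<bar> + \<bar>b - d\<bar>)" .
  have "b = d + (b - d)" by simp
  also have "\<dots> \<le> sup c d + (\<bar>a - c\<bar> + \<bar>b - d\<bar>)"
    by (intro add_mono sup_ge2 order_trans[OF abs_ge_self[of "b - d"]]) simp
  finally show "b \<le> sup c d + (\<bar>a - c\<bar> + \<bar>b - d\<bar>)" .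
qed

lemma abs_sup_diff_sup_le:
  fixes a b c d :: "'a::vector_lattice"
  shows "\<bar>sup a b - sup c d\<bar> \<le> \<bar>a - c\<bar> + \<bar>b - d\<bar>"
proof (rule abs_leI)
  show "sup a b - sup c d \<le> \<bar>a - c\<bar> + \<bar>b - d\<bar>"
    unfolding diff_le_eq using sup_le_sup_add_abs[of a b c d]
    by (simp only: add.commute[of _ "sup c d"])
  show "- (sup a b - sup c d) \<le> \<bar>a - c\<bar> + \<bar>b - d\<bar>"
    unfolding minus_diff_eq diff_le_eq using sup_le_sup_add_abs[of c d a b]
    by (simp only: add.commute[of _ "sup a b"] abs_minus_commute[of c a] abs_minus_commute[of d b])
qed

lemma archimedean_le:
  fixes a b w :: "'b::vector_lattice"
  assumes "archimedean_vl (vl_of_type :: 'b vl)" "0 \<le> w"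
    and "\<And>m::nat. m \<ge> 1 \<Longrightarrow> a \<le> b + (1 / real m) *\<^sub>R w"
  shows "a \<le> b"
proof -
  have "\<forall>m::nat. m \<ge> 1 \<longrightarrow> a - b \<le> (1 / real m) *\<^sub>R w"
    unfolding diff_le_eq using assms(3) by (auto simp only: add.commute[of _ b])
  then have "a - b \<le> 0"
    using assms(1,2) unfolding archimedean_vl_def vl_of_type_simps by blast
  then show ?thesis by simp
qed

locale vector_lattice_hom =
  fixes J :: "'a::vector_lattice \<Rightarrow> 'b::vector_lattice"
  assumes hom: "lattice_homomorphism J vl_of_type"
begin

lemma add: "J (x + y) = J x + J y"
  and scaleR: "J (a *\<^sub>R x) = a *\<^sub>R J x"
  and sup: "J (sup x y) = sup (J x) (J y)"
  using hom by (auto simp: lattice_homomorphism_def)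

lemma minus: "J (- x) = - J x"
  using scaleR[of "-1" x] by simp

lemma diff: "J (x - y) = J x - J y"
  using add[of x "- y"] by (simp add: minus)

lemma zero: "J 0 = 0"
  using scaleR[of 0 0] by simp

lemma mono: "x \<le> y \<Longrightarrow> J x \<le> J y"
  by (metis sup sup.absorb_iff2 sup_ge1)

lemma abs: "J \<bar>x\<bar> = \<bar>J x\<bar>"
  by (simp add: abs_lattice sup minus)

end

section \<open>Uniform approximation by the range of a homomorphism\<close>

text \<open>
  The regulator ranges over the range of \<open>J\<close>, not over the whole target. Condition (R) is an
  assumption on the source lattice only, so this is what makes it applicable to the regulators.
\<close>

definition ru_adherence :: "('a::vector_lattice \<Rightarrow> 'b::vector_lattice) \<Rightarrow> 'b set" where
  "ru_adherence J = {y. \<exists>u. \<forall>\<epsilon>>0. \<exists>x. \<bar>y - J x\<bar> \<le> \<epsilon> *\<^sub>R J u}"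

definition sublattice_vl :: "'b::vector_lattice set \<Rightarrow> 'b vl" where
  "sublattice_vl G = vl_of_type\<lparr>vl_carrier := G\<rparr>"

lemma sublattice_vl_simps [simp]:
  "vl_carrier (sublattice_vl G) = G" "vl_zero (sublattice_vl G) = 0"
  "vl_add (sublattice_vl G) = (+)" "vl_scale (sublattice_vl G) = scaleR"
  "vl_le (sublattice_vl G) = (\<le>)" "vl_sup (sublattice_vl G) = sup"
  "vl_inf (sublattice_vl G) = inf" "vl_minus (sublattice_vl G) = (-)"
  "vl_abs (sublattice_vl G) = abs"
  by (auto simp: sublattice_vl_def vl_minus_def vl_abs_def abs_lattice fun_eq_iff)

context vector_lattice_hom
begin

lemma range_ru_adherence: "J x \<in> ru_adherence J"
  unfolding ru_adherence_def
  by (rule CollectI, rule exI[of _ 0], intro allI impI, rule exI[of _ x]) (simp add: zero)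

lemma ru_adherence_add:
  assumes "y \<in> ru_adherence J" "z \<in> ru_adherence J"
  shows "y + z \<in> ru_adherence J"
proof -
  obtain u v where u: "\<And>\<epsilon>. \<epsilon> > 0 \<Longrightarrow> \<exists>x. \<bar>y - J x\<bar> \<le> \<epsilon> *\<^sub>R J u"
    and v: "\<And>\<epsilon>. \<epsilon> > 0 \<Longrightarrow> \<exists>x. \<bar>z - J x\<bar> \<le> \<epsilon> *\<^sub>R J v"
    using assms unfolding ru_adherence_def by blast
  have "\<exists>x. \<bar>y + z - J x\<bar> \<le> \<epsilon> *\<^sub>R J (u + v)" if eps: "\<epsilon> > 0" for \<epsilon>
  proof -
    obtain a b where a: "\<bar>y - J a\<bar> \<le> \<epsilon> *\<^sub>R J u" and b: "\<bar>z - J b\<bar> \<le> \<epsilon> *\<^sub>R J v"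
      using u[OF eps] v[OF eps] by blast
    have "\<bar>y + z - J (a + b)\<bar> \<le> \<bar>y - J a\<bar> + \<bar>z - J b\<bar>"
      using abs_triangle_ineq[of "y - J a" "z - J b"] by (simp add: add algebra_simps)
    also have "\<dots> \<le> \<epsilon> *\<^sub>R J u + \<epsilon> *\<^sub>R J v"
      by (intro add_mono a b)
    also have "\<dots> = \<epsilon> *\<^sub>R J (u + v)" by (simp add: add scaleR_add_right)
    finally show ?thesis by blast
  qed
  then show ?thesis unfolding ru_adherence_def by blast
qed

lemma ru_adherence_minus:
  assumes "y \<in> ru_adherence J"
  shows "- y \<in> ru_adherence J"
proof -
  obtain u where u: "\<And>\<epsilon>. \<epsilon> > 0 \<Longrightarrow> \<exists>x. \<bar>y - J x\<bar> \<le> \<epsilon> *\<^sub>R J u"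
    using assms unfolding ru_adherence_def by blast
  have "\<exists>x. \<bar>- y - J x\<bar> \<le> \<epsilon> *\<^sub>R J u" if eps: "\<epsilon> > 0" for \<epsilon>
  proof -
    obtain x where x: "\<bar>y - J x\<bar> \<le> \<epsilon> *\<^sub>R J u" using u[OF eps] by blast
    have "\<bar>- y - J (- x)\<bar> = \<bar>y - J x\<bar>"
      using abs_minus_commute[of y "J x"] by (simp add: minus)
    with x show ?thesis by (intro exI[of _ "- x"]) simp
  qed
  then show ?thesis unfolding ru_adherence_def by blast
qed

lemma ru_adherence_scaleR_nonneg:
  assumes "y \<in> ru_adherence J" "0 \<le> a"
  shows "a *\<^sub>R y \<in> ru_adherence J"
proof -
  obtain u where u: "\<And>\<epsilon>. \<epsilon> > 0 \<Longrightarrow> \<exists>x. \<bar>y - J x\<bar> \<le> \<epsilon> *\<^sub>R J u"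
    using assms unfolding ru_adherence_def by blast
  have "\<exists>x. \<bar>a *\<^sub>R y - J x\<bar> \<le> \<epsilon> *\<^sub>R J (a *\<^sub>R u)" if eps: "\<epsilon> > 0" for \<epsilon>
  proof -
    obtain x where x: "\<bar>y - J x\<bar> \<le> \<epsilon> *\<^sub>R J u" using u[OF eps] by blast
    have "\<bar>a *\<^sub>R y - J (a *\<^sub>R x)\<bar> = \<bar>a *\<^sub>R (y - J x)\<bar>"
      by (simp add: scaleR scaleR_diff_right)
    also have "\<dots> \<le> a *\<^sub>R \<bar>y - J x\<bar>" by (rule abs_scaleR_le) fact
    also have "\<dots> \<le> a *\<^sub>R (\<epsilon> *\<^sub>R J u)" by (intro scaleR_left_mono x assms)
    also have "\<dots> = \<epsilon> *\<^sub>R J (a *\<^sub>R u)" by (simp add: scaleR mult.commute)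
    finally show ?thesis by blast
  qed
  then show ?thesis unfolding ru_adherence_def by blast
qed

lemma ru_adherence_scaleR:
  assumes "y \<in> ru_adherence J"
  shows "a *\<^sub>R y \<in> ru_adherence J"
proof (cases "0 \<le> a")
  case True
  then show ?thesis using assms by (rule ru_adherence_scaleR_nonneg[rotated])
next
  case False
  then have "(- a) *\<^sub>R y \<in> ru_adherence J"
    by (intro ru_adherence_scaleR_nonneg assms) simp
  from ru_adherence_minus[OF this] show ?thesis by simp
qed

lemma ru_adherence_sup:
  assumes "y \<in> ru_adherence J" "z \<in> ru_adherence J"
  shows "sup y z \<in> ru_adherence J"
proof -
  obtain u v where u: "\<And>\<epsilon>. \<epsilon> > 0 \<Longrightarrow> \<exists>x. \<bar>y - J x\<bar> \<le> \<epsilon> *\<^sub>R J u"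
    and v: "\<And>\<epsilon>. \<epsilon> > 0 \<Longrightarrow> \<exists>x. \<bar>z - J x\<bar> \<le> \<epsilon> *\<^sub>R J v"
    using assms unfolding ru_adherence_def by blast
  have "\<exists>x. \<bar>sup y z - J x\<bar> \<le> \<epsilon> *\<^sub>R J (u + v)" if eps: "\<epsilon> > 0" for \<epsilon>
  proof -
    obtain a b where a: "\<bar>y - J a\<bar> \<le> \<epsilon> *\<^sub>R J u" and b: "\<bar>z - J b\<bar> \<le> \<epsilon> *\<^sub>R J v"
      using u[OF eps] v[OF eps] by blast
    have "\<bar>sup y z - J (sup a b)\<bar> \<le> \<bar>y - J a\<bar> + \<bar>z - J b\<bar>"
      unfolding sup by (rule abs_sup_diff_sup_le)
    also have "\<dots> \<le> \<epsilon> *\<^sub>R J u + \<epsilon> *\<^sub>R J v"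
      by (intro add_mono a b)
    also have "\<dots> = \<epsilon> *\<^sub>R J (u + v)" by (simp add: add scaleR_add_right)
    finally show ?thesis by blast
  qed
  then show ?thesis unfolding ru_adherence_def by blast
qed

lemma ru_adherence_inf:
  assumes "y \<in> ru_adherence J" "z \<in> ru_adherence J"
  shows "inf y z \<in> ru_adherence J"
  unfolding inf_eq_neg_sup
  by (intro ru_adherence_minus ru_adherence_sup assms)

lemma is_vector_lattice_ru_adherence: "is_vector_lattice (sublattice_vl (ru_adherence J))"
proof -
  have "0 \<in> ru_adherence J" using range_ru_adherence[of 0] by (simp add: zero)
  then show ?thesis
    by (intro is_vector_lattice.intro; simp only: sublattice_vl_simps)
      (auto simp: algebra_simps scaleR_left_mono
        ru_adherence_add ru_adherence_scaleR ru_adherence_sup ru_adherence_inf)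
qed

lemma archimedean_ru_adherence:
  assumes "archimedean_vl (vl_of_type :: 'b vl)"
  shows "archimedean_vl (sublattice_vl (ru_adherence J))"
  using assms is_vector_lattice_ru_adherence unfolding archimedean_vl_def by simp

text \<open>
  Completeness of the adherence concerns regulators from the adherence itself; this bound trades
  them for regulators from the range of \<open>J\<close>.
\<close>

lemma ru_adherence_majorized:
  assumes "y \<in> ru_adherence J"
  obtains v where "\<bar>y\<bar> \<le> J v"
proof -
  obtain u x where x: "\<bar>y - J x\<bar> \<le> 1 *\<^sub>R J u"
    using assms zero_less_one unfolding ru_adherence_def by blast
  have "\<bar>y\<bar> \<le> \<bar>y - J x\<bar> + \<bar>J x\<bar>"
    using abs_triangle_ineq[of "y - J x" "J x"] by simp
  also have "\<dots> \<le> J (u + \<bar>x\<bar>)" using x by (simp add: add abs)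
  finally show ?thesis by (rule that)
qed

text \<open>
  The diagonal argument for iterated limits: the regulators \<open>u k\<close> of the \<open>y k\<close> differ, and (R)
  makes all of them multiples of a single \<open>w\<close>. How large the multiple is does not matter, since
  each \<open>y k\<close> can be approximated with an error chosen after \<open>k\<close>.
\<close>

lemma ru_adherence_closed:
  assumes R: "condition_R TYPE('a)"
    and y: "\<And>k::nat. k \<ge> 1 \<Longrightarrow> \<exists>y\<in>ru_adherence J. \<bar>y - x\<bar> \<le> (1 / real k) *\<^sub>R J v"
  shows "x \<in> ru_adherence J"
proof -
  have "\<forall>k. \<exists>y\<in>ru_adherence J. \<bar>y - x\<bar> \<le> (1 / real (Suc k)) *\<^sub>R J v"
    using y by (metis Suc_le_eq One_nat_def zero_less_Suc)
  then obtain y where y_in: "\<And>k. y k \<in> ru_adherence J"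
    and y_le: "\<And>k. \<bar>y k - x\<bar> \<le> (1 / real (Suc k)) *\<^sub>R J v"
    by metis
  have "\<forall>k. \<exists>u. \<forall>\<epsilon>>0. \<exists>x. \<bar>y k - J x\<bar> \<le> \<epsilon> *\<^sub>R J u"
    using y_in unfolding ru_adherence_def by blast
  then obtain u where u: "\<And>k \<epsilon>. \<epsilon> > 0 \<Longrightarrow> \<exists>x. \<bar>y k - J x\<bar> \<le> \<epsilon> *\<^sub>R J (u k)"
    by metis
  obtain w c where c: "\<And>k::nat. (c k :: real) > 0" and w: "\<And>k. \<bar>c k *\<^sub>R u k\<bar> \<le> w"
    using R unfolding condition_R_def by metis
  have Jv: "0 \<le> J v"
    using order_trans[OF abs_ge_zero y_le[of 0]] by simp
  have "\<exists>z. \<bar>x - J z\<bar> \<le> \<epsilon> *\<^sub>R J (v + w)" if "\<epsilon> > 0" for \<epsilon>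
  proof -
    obtain k where k: "1 / real (Suc k) \<le> \<epsilon>"
      using nat_approx_posE[OF \<open>\<epsilon> > 0\<close>] by (metis less_imp_le)
    have "\<bar>y k - x\<bar> \<le> (1 / real (Suc k)) *\<^sub>R J v" by (rule y_le)
    also have "\<dots> \<le> \<epsilon> *\<^sub>R J v" by (intro scaleR_right_mono k Jv)
    finally have 1: "\<bar>y k - x\<bar> \<le> \<epsilon> *\<^sub>R J v" .
    obtain z where z: "\<bar>y k - J z\<bar> \<le> (\<epsilon> * c k) *\<^sub>R J (u k)"
      using u[of "\<epsilon> * c k" k] c[of k] \<open>\<epsilon> > 0\<close> by auto
    have "c k *\<^sub>R u k \<le> w" using order_trans[OF abs_ge_self w] .
    then have "c k *\<^sub>R J (u k) \<le> J w" using mono[of "c k *\<^sub>R u k" w] by (simp add: scaleR)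
    then have "\<epsilon> *\<^sub>R (c k *\<^sub>R J (u k)) \<le> \<epsilon> *\<^sub>R J w"
      using \<open>\<epsilon> > 0\<close> by (intro scaleR_left_mono) auto
    with z have 2: "\<bar>y k - J z\<bar> \<le> \<epsilon> *\<^sub>R J w" by simp
    have "\<bar>x - J z\<bar> \<le> \<bar>y k - x\<bar> + \<bar>y k - J z\<bar>"
      using abs_triangle_ineq[of "x - y k" "y k - J z"] by (simp add: abs_minus_commute)
    also have "\<dots> \<le> \<epsilon> *\<^sub>R J v + \<epsilon> *\<^sub>R J w" by (intro add_mono 1 2)
    also have "\<dots> = \<epsilon> *\<^sub>R J (v + w)" by (simp add: add scaleR_add_right)
    finally show ?thesis by blast
  qed
  then show ?thesis unfolding ru_adherence_def by blast
qed

end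

text \<open>
  In an Archimedean lattice the regulator of convergence of a ru-Cauchy net may be taken to be the
  regulator of the Cauchy condition: bound the distance to the limit through a later member of the
  net, whose distance to the limit is an arbitrarily small multiple of \<open>w\<close>. This matters when the
  limit is found in a larger lattice, to which \<open>w\<close> belongs.
\<close>

lemma ru_converges_cauchy_regulator:
  fixes f :: "'i \<Rightarrow> 'b::vector_lattice"
  assumes arch: "archimedean_vl (vl_of_type :: 'b vl)" and "\<Phi> \<noteq> bot"
    and cauchy: "ru_cauchy vl_of_type f \<Phi> u" and conv: "ru_converges vl_of_type f \<Phi> x w"
  shows "ru_converges vl_of_type f \<Phi> x u"
  unfolding ru_converges_def vl_of_type_simps
proof (intro allI impI)
  fix k :: nat assume "1 \<le> k"
  then obtain Q where Q: "eventually Q \<Phi>"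
    and Q_le: "\<And>i j. Q i \<Longrightarrow> Q j \<Longrightarrow> \<bar>f i - f j\<bar> \<le> (1 / real k) *\<^sub>R \<bar>u\<bar>"
    using cauchy unfolding ru_cauchy_def eventually_prod_same by fastforce
  have "\<bar>f i - x\<bar> \<le> (1 / real k) *\<^sub>R \<bar>u\<bar>" if "Q i" for i
  proof (rule archimedean_le[OF arch abs_ge_zero[of w]])
    fix m :: nat assume "m \<ge> 1"
    then have "\<forall>\<^sub>F j in \<Phi>. \<bar>f j - x\<bar> \<le> (1 / real m) *\<^sub>R \<bar>w\<bar>"
      using conv unfolding ru_converges_def by simp
    with Q have "\<forall>\<^sub>F j in \<Phi>. Q j \<and> \<bar>f j - x\<bar> \<le> (1 / real m) *\<^sub>R \<bar>w\<bar>"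
      by (rule eventually_conj)
    then obtain j where j: "Q j" "\<bar>f j - x\<bar> \<le> (1 / real m) *\<^sub>R \<bar>w\<bar>"
      using eventually_happens'[OF \<open>\<Phi> \<noteq> bot\<close>] by blast
    have "\<bar>f i - x\<bar> \<le> \<bar>f i - f j\<bar> + \<bar>f j - x\<bar>"
      using abs_triangle_ineq[of "f i - f j" "f j - x"] by simp
    also have "\<dots> \<le> (1 / real k) *\<^sub>R \<bar>u\<bar> + (1 / real m) *\<^sub>R \<bar>w\<bar>"
      by (intro add_mono Q_le that j)
    finally show "\<bar>f i - x\<bar> \<le> (1 / real k) *\<^sub>R \<bar>u\<bar> + (1 / real m) *\<^sub>R \<bar>w\<bar>" .
  qed
  with Q show "\<forall>\<^sub>F i in \<Phi>. \<bar>f i - x\<bar> \<le> (1 / real k) *\<^sub>R \<bar>u\<bar>"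
    by (rule eventually_mono)
qed

lemma (in vector_lattice_hom) ru_complete_ru_adherence:
  assumes R: "condition_R TYPE('a)" and complete: "ru_complete (vl_of_type :: 'b vl)"
  shows "ru_complete (sublattice_vl (ru_adherence J))"
  unfolding ru_complete_def
proof (intro conjI allI impI)
  let ?G = "sublattice_vl (ru_adherence J)"
  have arch: "archimedean_vl (vl_of_type :: 'b vl)"
    using complete by (simp add: ru_complete_def)
  then show "archimedean_vl ?G" by (rule archimedean_ru_adherence)
  fix \<Phi> :: "'b filter"
  assume "\<Phi> \<noteq> bot \<and> (\<forall>\<^sub>F y in \<Phi>. y \<in> vl_carrier ?G)
    \<and> (\<exists>u\<in>vl_carrier ?G. ru_cauchy ?G (\<lambda>y. y) \<Phi> u)"
  then obtain u where "\<Phi> \<noteq> bot" and ev: "\<forall>\<^sub>F y in \<Phi>. y \<in> ru_adherence J"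
    and u: "u \<in> ru_adherence J" and "ru_cauchy ?G (\<lambda>y. y) \<Phi> u"
    by auto
  then have cauchy: "ru_cauchy vl_of_type (\<lambda>y. y) \<Phi> u"
    by (simp add: ru_cauchy_def)
  obtain x w where "ru_converges vl_of_type (\<lambda>y. y) \<Phi> x w"
    using ru_complete_net[OF complete \<open>\<Phi> \<noteq> bot\<close> _ _ cauchy] by auto
  then have conv: "ru_converges vl_of_type (\<lambda>y. y) \<Phi> x u"
    by (rule ru_converges_cauchy_regulator[OF arch \<open>\<Phi> \<noteq> bot\<close> cauchy])
  obtain v where v: "\<bar>u\<bar> \<le> J v" using u by (rule ru_adherence_majorized)
  have "x \<in> ru_adherence J"
  proof (rule ru_adherence_closed[OF R])
    fix k :: nat assume "k \<ge> 1"
    then have "\<forall>\<^sub>F y in \<Phi>. \<bar>y - x\<bar> \<le> (1 / real k) *\<^sub>R \<bar>u\<bar>"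
      using conv by (simp add: ru_converges_def)
    with ev have "\<forall>\<^sub>F y in \<Phi>. y \<in> ru_adherence J \<and> \<bar>y - x\<bar> \<le> (1 / real k) *\<^sub>R \<bar>u\<bar>"
      by (rule eventually_conj)
    then obtain y where "y \<in> ru_adherence J" "\<bar>y - x\<bar> \<le> (1 / real k) *\<^sub>R \<bar>u\<bar>"
      using eventually_happens'[OF \<open>\<Phi> \<noteq> bot\<close>] by blast
    moreover have "(1 / real k) *\<^sub>R \<bar>u\<bar> \<le> (1 / real k) *\<^sub>R J v"
      by (intro scaleR_left_mono v) simp
    ultimately show "\<exists>y\<in>ru_adherence J. \<bar>y - x\<bar> \<le> (1 / real k) *\<^sub>R J v"
      by (blast intro: order_trans)
  qed
  moreover have "ru_converges ?G (\<lambda>y. y) \<Phi> x u"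
    using conv by (simp add: ru_converges_def)
  ultimately show "\<exists>x\<in>vl_carrier ?G. \<exists>w\<in>vl_carrier ?G. ru_converges ?G (\<lambda>y. y) \<Phi> x w"
    using u by auto
qed

lemma ru_completion_ru_adherence:
  fixes J :: "'a::vector_lattice \<Rightarrow> 'b::vector_lattice"
  assumes R: "condition_R TYPE('a)" and J: "ru_completion J"
  shows "y \<in> ru_adherence J"
proof -
  have complete: "ru_complete (vl_of_type :: 'b vl)"
    and hom: "lattice_homomorphism J vl_of_type"
    and universal: "\<And>(Y :: 'b vl) T. ru_complete Y \<Longrightarrow> lattice_homomorphism T Y \<Longrightarrow>
      \<exists>!S. lattice_homomorphism S Y \<and> S \<circ> J = T"
    using J unfolding ru_completion_def by blast+
  interpret vector_lattice_hom J by unfold_locales (fact hom)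
  let ?G = "sublattice_vl (ru_adherence J)"
  have "lattice_homomorphism J ?G"
    using hom range_ru_adherence by (simp add: lattice_homomorphism_def)
  then obtain S where S: "lattice_homomorphism S ?G" "S \<circ> J = J"
    using universal[OF ru_complete_ru_adherence[OF R complete]] by blast
  have "lattice_homomorphism S vl_of_type"
    using S(1) by (simp add: lattice_homomorphism_def)
  moreover have "lattice_homomorphism id (vl_of_type :: 'b vl)"
    by (simp add: lattice_homomorphism_def)
  ultimately have "S = id"
    using universal[OF complete hom] S(2) by (metis id_comp)
  then show ?thesis using S(1) by (auto simp: lattice_homomorphism_def)
qed

section \<open>Positive semigroups\<close>

locale pos_semigroup =
  fixes T :: "real \<Rightarrow> 'a::vector_lattice \<Rightarrow> 'a"
  assumes positive_semigroup: "positive_semigroup T"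
begin

lemma linear: "s \<ge> 0 \<Longrightarrow> linear (T s)"
  and semigroup: "s \<ge> 0 \<Longrightarrow> t \<ge> 0 \<Longrightarrow> T (s + t) x = T s (T t x)"
  and nonneg: "s \<ge> 0 \<Longrightarrow> x \<ge> 0 \<Longrightarrow> T s x \<ge> 0"
  using positive_semigroup by (auto simp: positive_semigroup_def semigroup_on_def)

lemma diff: "s \<ge> 0 \<Longrightarrow> T s (x - y) = T s x - T s y"
  by (simp add: linear linear_diff)

lemma mono: "s \<ge> 0 \<Longrightarrow> x \<le> y \<Longrightarrow> T s x \<le> T s y"
  using nonneg[of s "y - x"] by (simp add: diff)

lemma abs_le: "s \<ge> 0 \<Longrightarrow> \<bar>T s x\<bar> \<le> T s \<bar>x\<bar>"
  using mono[OF _ abs_ge_self[of x], of s] mono[OF _ abs_ge_minus_self[of x], of s]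
  by (intro abs_leI) (simp_all add: linear linear_neg)

lemma abs_le_of_abs_le: "s \<ge> 0 \<Longrightarrow> \<bar>x\<bar> \<le> y \<Longrightarrow> \<bar>T s x\<bar> \<le> T s y"
  by (blast intro: order_trans abs_le mono)

lemma abs_le_of_abs_le_scaleR: "s \<ge> 0 \<Longrightarrow> \<bar>x\<bar> \<le> a *\<^sub>R y \<Longrightarrow> \<bar>T s x\<bar> \<le> a *\<^sub>R T s y"
  using abs_le_of_abs_le[of s x "a *\<^sub>R y"] by (simp add: linear linear_scale)

lemma orbit_order_bounded:
  assumes "ruc0 T"
  obtains b where "\<And>t. 0 \<le> t \<Longrightarrow> t \<le> s \<Longrightarrow> \<bar>T t x\<bar> \<le> b"
proof -
  obtain u where u: "\<forall>\<epsilon>>0. \<exists>\<delta>>0. \<forall>h. 0 \<le> h \<and> h < \<delta> \<longrightarrow> \<bar>T h x - x\<bar> \<le> \<epsilon> *\<^sub>R \<bar>u\<bar>"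
    using assms unfolding ruc0_def by blast
  obtain \<delta> where "\<delta> > 0" and \<delta>: "\<And>h. 0 \<le> h \<Longrightarrow> h < \<delta> \<Longrightarrow> \<bar>T h x - x\<bar> \<le> 1 *\<^sub>R \<bar>u\<bar>"
    using u zero_less_one by blast
  define v where "v = \<bar>u\<bar> + \<bar>x\<bar>"
  have v: "\<bar>T h x\<bar> \<le> v" if "0 \<le> h" "h < \<delta>" for h
  proof -
    have "\<bar>T h x\<bar> \<le> \<bar>T h x - x\<bar> + \<bar>x\<bar>"
      using abs_triangle_ineq[of "T h x - x" x] by simp
    with \<delta>[OF that] show ?thesis unfolding v_def by (auto intro: order_trans)
  qed
  have "0 \<le> v" by (simp add: v_def)
  define N where "N = nat \<lfloor>s / \<delta>\<rfloor>"
  show ?thesis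
  proof (rule that)
    fix t assume t: "0 \<le> t" "t \<le> s"
    \<comment> \<open>Division with remainder: \<open>t = k * \<delta> + h\<close>, with \<open>h\<close> in the initial piece of the orbit.\<close>
    define k where "k = nat \<lfloor>t / \<delta>\<rfloor>"
    define h where "h = t - real k * \<delta>"
    have "real k = of_int \<lfloor>t / \<delta>\<rfloor>" using t \<open>\<delta> > 0\<close> by (simp add: k_def)
    then have "real k \<le> t / \<delta>" "t / \<delta> < real k + 1" by linarith+
    then have h: "0 \<le> h" "h < \<delta>"
      using \<open>\<delta> > 0\<close> by (auto simp: h_def field_simps)
    have "k \<le> N"
      unfolding k_def N_def using t \<open>\<delta> > 0\<close>
      by (intro nat_mono floor_mono divide_right_mono) auto
    have k\<delta>: "0 \<le> real i * \<delta>" for i using \<open>\<delta> > 0\<close> by simp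
    have "\<bar>T t x\<bar> = \<bar>T (real k * \<delta>) (T h x)\<bar>"
      using semigroup[OF k\<delta> h(1), of k x] by (simp add: h_def)
    also have "\<dots> \<le> T (real k * \<delta>) v"
      by (intro abs_le_of_abs_le k\<delta> v h)
    also have "\<dots> \<le> (\<Sum>i\<le>N. T (real i * \<delta>) v)"
      using sum_mono2[of "{..N}" "{k}" "\<lambda>i. T (real i * \<delta>) v"] \<open>k \<le> N\<close>
      by (simp add: nonneg k\<delta> \<open>0 \<le> v\<close>)
    finally show "\<bar>T t x\<bar> \<le> (\<Sum>i\<le>N. T (real i * \<delta>) v)" .
  qed
qed

text \<open>
  Continuity from the left is the delicate part: there the increment is the image of
  \<open>x - T (- h) x\<close> under an operator that varies with \<open>h\<close>, so a bound for the whole orbit of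
  the regulator \<open>u\<close> on the interval from \<open>0\<close> to \<open>s\<close> is needed.
\<close>

lemma ruc_of_ruc0:
  assumes "ruc0 T"
  shows "ruc T"
  unfolding ruc_def
proof (intro allI impI)
  fix x and s :: real assume s: "s \<ge> 0"
  obtain u where u: "\<forall>\<epsilon>>0. \<exists>\<delta>>0. \<forall>h. 0 \<le> h \<and> h < \<delta> \<longrightarrow> \<bar>T h x - x\<bar> \<le> \<epsilon> *\<^sub>R \<bar>u\<bar>"
    using assms unfolding ruc0_def by blast
  obtain b where b: "\<And>t. 0 \<le> t \<Longrightarrow> t \<le> s \<Longrightarrow> \<bar>T t \<bar>u\<bar>\<bar> \<le> b"
    using orbit_order_bounded[OF assms] by blast
  have Tu: "\<epsilon> *\<^sub>R T t \<bar>u\<bar> \<le> \<epsilon> *\<^sub>R \<bar>b\<bar>" if "0 \<le> t" "t \<le> s" "\<epsilon> > 0" for t \<epsilon>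
  proof -
    have "T t \<bar>u\<bar> \<le> \<bar>b\<bar>"
      by (rule order_trans[OF order_trans[OF abs_ge_self b[OF that(1,2)]] abs_ge_self])
    then show ?thesis using that by (intro scaleR_left_mono) auto
  qed
  show "\<exists>u. \<forall>\<epsilon>>0. \<exists>\<delta>>0. \<forall>h. \<bar>h\<bar> < \<delta> \<and> s + h \<ge> 0 \<longrightarrow>
    \<bar>T (s + h) x - T s x\<bar> \<le> \<epsilon> *\<^sub>R \<bar>u\<bar>"
  proof (intro exI[of _ b] allI impI)
    fix \<epsilon> :: real assume "\<epsilon> > 0"
    with u obtain \<delta> where "\<delta> > 0"
      and \<delta>: "\<And>h. 0 \<le> h \<Longrightarrow> h < \<delta> \<Longrightarrow> \<bar>T h x - x\<bar> \<le> \<epsilon> *\<^sub>R \<bar>u\<bar>"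
      by blast
    have "\<bar>T (s + h) x - T s x\<bar> \<le> \<epsilon> *\<^sub>R \<bar>b\<bar>" if h: "\<bar>h\<bar> < \<delta>" "s + h \<ge> 0" for h
    proof (cases "0 \<le> h")
      case True
      have "\<bar>T (s + h) x - T s x\<bar> = \<bar>T s (T h x - x)\<bar>"
        using s True by (simp add: semigroup diff)
      also have "\<dots> \<le> \<epsilon> *\<^sub>R T s \<bar>u\<bar>"
        using s True h by (intro abs_le_of_abs_le_scaleR \<delta>) auto
      also have "\<dots> \<le> \<epsilon> *\<^sub>R \<bar>b\<bar>" using s \<open>\<epsilon> > 0\<close> by (intro Tu) auto
      finally show ?thesis .
    next
      case False
      have "T s x = T (s + h) (T (- h) x)"
        using semigroup[of "s + h" "- h" x] h False by simp
      then have "\<bar>T (s + h) x - T s x\<bar> = \<bar>T (s + h) (T (- h) x - x)\<bar>"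
        using h by (simp add: diff abs_minus_commute)
      also have "\<dots> \<le> \<epsilon> *\<^sub>R T (s + h) \<bar>u\<bar>"
        using False h by (intro abs_le_of_abs_le_scaleR \<delta>) auto
      also have "\<dots> \<le> \<epsilon> *\<^sub>R \<bar>b\<bar>" using False h \<open>\<epsilon> > 0\<close> by (intro Tu) auto
      finally show ?thesis .
    qed
    with \<open>\<delta> > 0\<close> show "\<exists>\<delta>>0. \<forall>h. \<bar>h\<bar> < \<delta> \<and> s + h \<ge> 0 \<longrightarrow>
      \<bar>T (s + h) x - T s x\<bar> \<le> \<epsilon> *\<^sub>R \<bar>b\<bar>" by blast
  qed
qed

end

section \<open>The extended semigroup\<close>

theorem theorem3:
  fixes T :: "real \<Rightarrow> 'a::vector_lattice \<Rightarrow> 'a"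
    and J :: "'a \<Rightarrow> 'b::vector_lattice"
    and Tr :: "real \<Rightarrow> 'b \<Rightarrow> 'b"
  assumes "archimedean_vl (vl_of_type :: 'a vl)"
    and "condition_R TYPE('a)"
    and "positive_semigroup T"
    and "ruc0 T"
    and "ru_completion J"
    and "positive_semigroup Tr"
    and "\<And>s x. s \<ge> 0 \<Longrightarrow> Tr s (J x) = J (T s x)"
  shows "ruc Tr"
proof -
  interpret J: vector_lattice_hom J
    using assms(5) by unfold_locales (simp add: ru_completion_def)
  interpret T: pos_semigroup T by unfold_locales (fact assms(3))
  interpret Tr: pos_semigroup Tr by unfold_locales (fact assms(6))
  have ruc_T: "ruc T" using assms(4) by (rule T.ruc_of_ruc0)
  show ?thesis
    unfolding ruc_def
  proof (intro allI impI)
    fix y and s :: real assume s: "s \<ge> 0"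
    have "y \<in> ru_adherence J"
      using assms(2,5) by (rule ru_completion_ru_adherence)
    then obtain u where u: "\<And>\<epsilon>. \<epsilon> > 0 \<Longrightarrow> \<exists>x. \<bar>y - J x\<bar> \<le> \<epsilon> *\<^sub>R J u"
      unfolding ru_adherence_def by blast
    have "\<forall>n. \<exists>x. \<bar>y - J x\<bar> \<le> (1 / real (Suc n)) *\<^sub>R J u"
      using u by simp
    then obtain x where x: "\<And>n. \<bar>y - J (x n)\<bar> \<le> (1 / real (Suc n)) *\<^sub>R J u"
      by metis
    have Ju: "0 \<le> J u"
      using order_trans[OF abs_ge_zero x[of 0]] by simp
    have "\<forall>n. \<exists>v. \<forall>\<epsilon>>0. \<exists>\<delta>>0. \<forall>h. \<bar>h\<bar> < \<delta> \<and> s + h \<ge> 0 \<longrightarrow>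
        \<bar>T (s + h) (x n) - T s (x n)\<bar> \<le> \<epsilon> *\<^sub>R \<bar>v\<bar>"
      using ruc_T s unfolding ruc_def by blast
    then obtain v where v: "\<And>n \<epsilon>. \<epsilon> > 0 \<Longrightarrow> \<exists>\<delta>>0. \<forall>h. \<bar>h\<bar> < \<delta> \<and> s + h \<ge> 0 \<longrightarrow>
        \<bar>T (s + h) (x n) - T s (x n)\<bar> \<le> \<epsilon> *\<^sub>R \<bar>v n\<bar>"
      by metis
    obtain w c where c: "\<And>n::nat. (c n :: real) > 0" and w: "\<And>n. \<bar>c n *\<^sub>R v n\<bar> \<le> w"
      using assms(2) unfolding condition_R_def by metis
    \<comment> \<open>The interval reaches beyond \<open>s\<close> so that the bound also covers times slightly larger than \<open>s\<close>.\<close>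
    obtain b where b: "\<And>t. 0 \<le> t \<Longrightarrow> t \<le> s + 1 \<Longrightarrow> \<bar>T t u\<bar> \<le> b"
      using T.orbit_order_bounded[OF assms(4)] by blast
    show "\<exists>u. \<forall>\<epsilon>>0. \<exists>\<delta>>0. \<forall>h. \<bar>h\<bar> < \<delta> \<and> s + h \<ge> 0 \<longrightarrow>
      \<bar>Tr (s + h) y - Tr s y\<bar> \<le> \<epsilon> *\<^sub>R \<bar>u\<bar>"
    proof (intro exI[of _ "J (b + w + b)"] allI impI)
      fix \<epsilon> :: real assume "\<epsilon> > 0"
      obtain n where n: "1 / real (Suc n) \<le> \<epsilon>"
        using nat_approx_posE[OF \<open>\<epsilon> > 0\<close>] by (metis less_imp_le)
      have "(1 / real (Suc n)) *\<^sub>R J u \<le> \<epsilon> *\<^sub>R J u" by (intro scaleR_right_mono n Ju)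
      with x[of n] have yx: "\<bar>y - J (x n)\<bar> \<le> \<epsilon> *\<^sub>R J u" by (rule order_trans)
      have err: "\<bar>Tr t y - J (T t (x n))\<bar> \<le> \<epsilon> *\<^sub>R J b" if t: "0 \<le> t" "t \<le> s + 1" for t
      proof -
        have "\<bar>Tr t y - J (T t (x n))\<bar> = \<bar>Tr t (y - J (x n))\<bar>"
          using t by (simp add: Tr.diff assms(7))
        also have "\<dots> \<le> \<epsilon> *\<^sub>R Tr t (J u)"
          by (intro Tr.abs_le_of_abs_le_scaleR t yx)
        also have "\<dots> = \<epsilon> *\<^sub>R J (T t u)" using t by (simp add: assms(7))
        also have "\<dots> \<le> \<epsilon> *\<^sub>R J b"
          using order_trans[OF abs_ge_self b[OF t]] \<open>\<epsilon> > 0\<close>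
          by (intro scaleR_left_mono J.mono) auto
        finally show ?thesis .
      qed
      obtain \<delta> where "\<delta> > 0" and \<delta>: "\<And>h. \<bar>h\<bar> < \<delta> \<Longrightarrow> s + h \<ge> 0 \<Longrightarrow>
          \<bar>T (s + h) (x n) - T s (x n)\<bar> \<le> (\<epsilon> * c n) *\<^sub>R \<bar>v n\<bar>"
        using v[of "\<epsilon> * c n" n] c[of n] \<open>\<epsilon> > 0\<close> by auto
      have incr: "\<bar>J (T (s + h) (x n)) - J (T s (x n))\<bar> \<le> \<epsilon> *\<^sub>R J w"
        if "\<bar>h\<bar> < \<delta>" "s + h \<ge> 0" for h
      proof -
        have "(\<epsilon> * c n) *\<^sub>R \<bar>v n\<bar> \<le> (\<epsilon> * c n) *\<^sub>R (inverse (c n) *\<^sub>R w)"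
          using c[of n] \<open>\<epsilon> > 0\<close>
          by (intro scaleR_left_mono abs_le_inverse_scaleR[OF c w]) auto
        also have "\<dots> = \<epsilon> *\<^sub>R w" using c[of n] by simp
        finally have "J \<bar>T (s + h) (x n) - T s (x n)\<bar> \<le> J (\<epsilon> *\<^sub>R w)"
          using \<delta>[OF that] by (intro J.mono) (rule order_trans)
        then show ?thesis by (simp add: J.abs J.diff J.scaleR)
      qed
      have "\<bar>Tr (s + h) y - Tr s y\<bar> \<le> \<epsilon> *\<^sub>R \<bar>J (b + w + b)\<bar>"
        if h: "\<bar>h\<bar> < min \<delta> 1" "s + h \<ge> 0" for h
      proof -
        let ?p = "Tr (s + h) y - J (T (s + h) (x n))"
          and ?q = "J (T (s + h) (x n)) - J (T s (x n))"
          and ?r = "J (T s (x n)) - Tr s y"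
        have "\<bar>Tr (s + h) y - Tr s y\<bar> = \<bar>?p + ?q + ?r\<bar>" by simp
        also have "\<dots> \<le> \<bar>?p\<bar> + \<bar>?q\<bar> + \<bar>?r\<bar>"
          by (intro order_trans[OF abs_triangle_ineq] add_mono abs_triangle_ineq order_refl)
        also have "\<dots> \<le> \<epsilon> *\<^sub>R J b + \<epsilon> *\<^sub>R J w + \<epsilon> *\<^sub>R J b"
          using err[of "s + h"] err[of s] incr[of h] h s
          by (intro add_mono) (auto simp: abs_minus_commute)
        also have "\<dots> = \<epsilon> *\<^sub>R J (b + w + b)" by (simp add: J.add scaleR_add_right)
        also have "\<dots> \<le> \<epsilon> *\<^sub>R \<bar>J (b + w + b)\<bar>"
          using \<open>\<epsilon> > 0\<close> by (intro scaleR_left_mono abs_ge_self) simp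
        finally show ?thesis .
      qed
      then show "\<exists>\<delta>>0. \<forall>h. \<bar>h\<bar> < \<delta> \<and> s + h \<ge> 0 \<longrightarrow>
          \<bar>Tr (s + h) y - Tr s y\<bar> \<le> \<epsilon> *\<^sub>R \<bar>J (b + w + b)\<bar>"
        using \<open>\<delta> > 0\<close> by (intro exI[of _ "min \<delta> 1"]) auto
    qed
  qed
qed

end
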